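(* Let $Y$ be a real Hilbert space and let $h: Y \to \mathbb{R}\cup\{+\infty\}$ be a closed, proper, convex function. Let $(\lambda_\star^{k+1}, s_\star^{k+1}, \lambda^{k+1}, s^{k+1})_{k\in\mathbb{N}}$ be generated by the inexact proximal point algorithm (IPPA) on $h$ with errors $(\varepsilon_k)_{k\ge 1}$ and step sizes $(\gamma_k)_{k\ge 0}$ satisfying the error and step-size conditions (see context). Let $\bar s = \operatorname{argmin}_{s\in \operatorname{cl}(\operatorname{range}(\partial h))}\|s\|^2$. Then the sequence $(h^*(s_\star^k))_{k\ge 1}$ converges in $\mathbb{R}\cup\{+\infty\}$ to $h^*(\bar s)$.
   Context: Closed means lower semicontinuous. $h^*(s)=\sup_{\lambda\in Y}\langle s,\lambda\rangle - h(\lambda)$ is the convex conjugate, $\partial h$ the subdifferential, $\operatorname{range}(\partial h)=\bigcup_\lambda \partial h(\lambda)$, and $\operatorname{Prox}_{\gamma h}(\lambda)=\operatorname{argmin}_{\mu\in Y}\left(h(\mu)+\tfrac{1}{2\gamma}\|\lambda-\mu\|^2\right)$ for $\gamma>0$. The set $\operatorname{cl}(\operatorname{range}(\partial h))$ is a nonempty closed convex set, so $\bar s$ is its unique element of minimal norm. IPPA on $h$: given $\lambda^0\in Y$, $\gamma_k>0$ ($k\ge 0$) and $\varepsilon_k\ge 0$ ($k\ge 1$), for $k=0,1,2,\dots$: $\lambda_\star^{k+1}=\operatorname{Prox}_{\gamma_k h}(\lambda^k)$; $s_\star^{k+1}=(\lambda^k-\lambda_\star^{k+1})/\gamma_k$;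 $\lambda^{k+1}\in Y$ is any point with $\|\lambda^{k+1}-\lambda_\star^{k+1}\|\le\varepsilon_{k+1}$; $s^{k+1}=(\lambda^k-\lambda^{k+1})/\gamma_k$. Error and step-size conditions: $\gamma_k>0$, $\varepsilon_k\ge 0$, and (A1) $\sum_{k=1}^\infty\varepsilon_k<\infty$; (A2) $\frac{\varepsilon_{k+1}}{\gamma_k}\sum_{i=0}^k\gamma_i=O\left(\frac{1}{\sqrt{\sum_{i=0}^k\gamma_i}}\right)$; (A3) $\sum_{k=1}^\infty\left((\varepsilon_k/\gamma_k)^2\sum_{i=0}^{k-1}\gamma_i\right)<\infty$; (A4) $\sum_{k=1}^\infty\left((\varepsilon_k/\gamma_k)\sum_{i=1}^{k}\gamma_{i-1}\right)<\infty$; (A5) $\sum_{k=0}^\infty\gamma_k=\infty$. *)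

theory Defs
  imports "HOL-Analysis.Analysis"
begin

text \<open>
  Functions with values in the reals extended by plus infinity are rendered as
  \<open>ereal\<close>-valued functions; the value minus infinity is excluded by \<open>proper_fun\<close>.
\<close>

definition proper_fun :: "('a \<Rightarrow> ereal) \<Rightarrow> bool" where
  "proper_fun h \<longleftrightarrow> (\<forall>x. h x \<noteq> - \<infinity>) \<and> (\<exists>x. h x \<noteq> \<infinity>)"

definition closed_fun :: "('a::topological_space \<Rightarrow> ereal) \<Rightarrow> bool" where
  "closed_fun h \<longleftrightarrow> (\<forall>x. h x \<le> Liminf (at x) h)"

text \<open>In \<open>ereal\<close>, zero times infinity is zero, so the endpoints of the segment are harmless.\<close>

definition convex_fun :: "('a::real_vector \<Rightarrow> ereal) \<Rightarrow> bool" where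
  "convex_fun h \<longleftrightarrow>
     (\<forall>x y. \<forall>t\<in>{0..1::real}.
        h ((1 - t) *\<^sub>R x + t *\<^sub>R y) \<le> ereal (1 - t) * h x + ereal t * h y)"

definition conjugate :: "('a::real_inner \<Rightarrow> ereal) \<Rightarrow> 'a \<Rightarrow> ereal" where
  "conjugate h s = (SUP x. ereal (s \<bullet> x) - h x)"

text \<open>For proper \<open>h\<close> this is empty at every point where \<open>h\<close> takes the value plus infinity.\<close>

definition subdifferential :: "('a::real_inner \<Rightarrow> ereal) \<Rightarrow> 'a \<Rightarrow> 'a set" where
  "subdifferential h x = {s. \<forall>y. h x + ereal (s \<bullet> (y - x)) \<le> h y}"

definition range_subdifferential :: "('a::real_inner \<Rightarrow> ereal) \<Rightarrow> 'a set" where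
  "range_subdifferential h = (\<Union>x. subdifferential h x)"

definition prox :: "real \<Rightarrow> ('a::real_inner \<Rightarrow> ereal) \<Rightarrow> 'a \<Rightarrow> 'a" where
  "prox \<gamma> h x = arg_min_on (\<lambda>y. h y + ereal ((norm (x - y))\<^sup>2 / (2 * \<gamma>))) UNIV"

text \<open>
  \<open>ippa h \<gamma> \<epsilon> ls ss l s\<close>: the iterates \<open>ls\<close> (exact proximal points) with quotients \<open>ss\<close>,
  and \<open>l\<close> (inexact points) with quotients \<open>s\<close>, form a run of the inexact proximal point
  algorithm started at \<open>l 0\<close>. The values \<open>\<epsilon> 0\<close>, \<open>ls 0\<close>, \<open>ss 0\<close> and \<open>s 0\<close> are unconstrained
  and play no role.
\<close>

definition ippa ::
  "('a::real_inner \<Rightarrow> ereal) \<Rightarrow> (nat \<Rightarrow> real) \<Rightarrow> (nat \<Rightarrow> real) \<Rightarrow>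
   (nat \<Rightarrow> 'a) \<Rightarrow> (nat \<Rightarrow> 'a) \<Rightarrow> (nat \<Rightarrow> 'a) \<Rightarrow> (nat \<Rightarrow> 'a) \<Rightarrow> bool" where
  "ippa h \<gamma> \<epsilon> ls ss l s \<longleftrightarrow>
     (\<forall>k. ls (Suc k) = prox (\<gamma> k) h (l k) \<and>
          ss (Suc k) = (l k - ls (Suc k)) /\<^sub>R \<gamma> k \<and>
          norm (l (Suc k) - ls (Suc k)) \<le> \<epsilon> (Suc k) \<and>
          s (Suc k) = (l k - l (Suc k)) /\<^sub>R \<gamma> k)"

text \<open>Series indexed from 1 are written with the summation index shifted to \<open>Suc k\<close>.\<close>

definition error_step_conditions :: "(nat \<Rightarrow> real) \<Rightarrow> (nat \<Rightarrow> real) \<Rightarrow> bool" where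
  "error_step_conditions \<gamma> \<epsilon> \<longleftrightarrow>
     (\<forall>k. \<gamma> k > 0) \<and>
     (\<forall>k. \<epsilon> (Suc k) \<ge> 0) \<and>
     summable (\<lambda>k. \<epsilon> (Suc k)) \<and>
     (\<lambda>k. \<epsilon> (Suc k) / \<gamma> k * (\<Sum>i=0..k. \<gamma> i)) \<in> O(\<lambda>k. 1 / sqrt (\<Sum>i=0..k. \<gamma> i)) \<and>
     summable (\<lambda>k. (\<epsilon> (Suc k) / \<gamma> (Suc k))\<^sup>2 * (\<Sum>i=0..k. \<gamma> i)) \<and>
     summable (\<lambda>k. \<epsilon> (Suc k) / \<gamma> (Suc k) * (\<Sum>i=1..Suc k. \<gamma> (i - 1))) \<and>
     filterlim (\<lambda>n. \<Sum>k=0..n. \<gamma> k) at_top sequentially"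

end

theory Submission
  imports Defs
begin

text \<open>
  Write \<open>p\<^sub>n\<close> and \<open>g\<^sub>n \<in> \<partial>h(p\<^sub>n)\<close> for the exact proximal points and their residuals, and \<open>G\<^sub>n\<close> for
  the sum of the step sizes. For \<open>u\<close> in the domain of \<open>h\<close>, the function
  \<open>\<parallel>p\<^sub>n - u\<parallel>\<^sup>2/2 + G\<^sub>n (h(p\<^sub>n) - h(u)) + G\<^sub>n\<^sup>2 \<parallel>g\<^sub>n\<parallel>\<^sup>2/2\<close> is nonincreasing along the exact algorithm, and the
  errors raise it by only \<open>o(G\<^sub>n)\<close>. Inserting \<open>h(p) \<ge> \<langle>z, p\<rangle> - h\<^sup>*(z)\<close> and completing the square gives
  \<open>\<parallel>p\<^sub>n - u + G\<^sub>n z\<parallel>\<^sup>2/2 + G\<^sub>n\<^sup>2 (\<parallel>g\<^sub>n\<parallel>\<^sup>2 - \<parallel>z\<parallel>\<^sup>2)/2 \<le> G\<^sub>n (h(u) + h\<^sup>*(z) - \<langle>z, u\<rangle> + o(1))\<close>.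
  Taking \<open>z\<close> in the range of the subdifferential yields strong convergence of \<open>g\<^sub>n\<close> to the element
  \<open>s\<close> of minimal norm, hence \<open>liminf h\<^sup>*(g\<^sub>n) \<ge> h\<^sup>*(s)\<close>. If \<open>h\<^sup>*(s)\<close> is finite, taking \<open>z = s\<close> bounds
  \<open>h\<^sup>*(g\<^sub>n) - h\<^sup>*(s) \<le> \<langle>p\<^sub>n, g\<^sub>n - s\<rangle>\<close> by \<open>h(u) + h\<^sup>*(s) - \<langle>s, u\<rangle> + o(1)\<close>, and the choice of \<open>u\<close> makes
  this arbitrarily small.
\<close>

section \<open>Minimizers in Hilbert space and a Kronecker lemma\<close>

text \<open>\<open>closed_fun\<close> sees only punctured neighbourhoods, while \<open>X\<close> may
  hit \<open>x\<close>. The value at \<open>x\<close> also exceeds \<open>q\<close>, so the bound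
  holds on full neighbourhoods.\<close>

lemma closed_fun_sequential_le:
  fixes h :: "'a::topological_space \<Rightarrow> ereal"
  assumes "closed_fun h" "X \<longlonglongrightarrow> x" "c \<longlonglongrightarrow> c'" "\<And>n. h (X n) \<le> ereal (c n)"
  shows "h x \<le> ereal c'"
proof (rule ccontr)
  assume "\<not> h x \<le> ereal c'"
  then obtain q where q: "ereal c' < ereal q" "ereal q < h x"
    using ereal_dense2 by (metis not_le)
  then have "ereal q < Liminf (at x) h"
    using assms(1) unfolding closed_fun_def by (metis order_less_le_trans)
  then have "\<forall>\<^sub>F y in at x. ereal q < h y"
    by (rule less_LiminfD)
  then have "\<forall>\<^sub>F y in nhds x. ereal q < h y"
    unfolding eventually_at_filter by (rule eventually_mono) (metis UNIV_I q(2))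
  then have "\<forall>\<^sub>F n in sequentially. ereal q < h (X n)"
    using assms(2) unfolding filterlim_iff by blast
  moreover have "\<forall>\<^sub>F n in sequentially. c n < q"
    using assms(3) q by (auto intro: order_tendstoD)
  ultimately have "\<forall>\<^sub>F n in sequentially. False"
  proof eventually_elim
    case (elim n)
    with assms(4)[of n] have "ereal q < ereal (c n)" by (metis order_less_le_trans)
    with elim show ?case by simp
  qed
  then show False by simp
qed

text \<open>A minimizing sequence is Cauchy: midpoints stay above the infimum, so the gain
  \<open>c * (norm (x - y))\<^sup>2\<close> is at most the mean excess of the two values. The last
  hypothesis joins closedness and semicontinuity, so \<open>D\<close> may be a domain that is not
  closed.\<close>

lemma uniformly_convex_attains_inf:
  fixes F :: "'a::{real_inner, complete_space} \<Rightarrow> real"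
  assumes "D \<noteq> {}" and bdd: "\<And>x. x \<in> D \<Longrightarrow> b \<le> F x" and "c > 0"
    and mid: "\<And>x y. x \<in> D \<Longrightarrow> y \<in> D \<Longrightarrow> midpoint x y \<in> D"
      "\<And>x y. x \<in> D \<Longrightarrow> y \<in> D \<Longrightarrow> F (midpoint x y) + c * (norm (x - y))\<^sup>2 \<le> (F x + F y) / 2"
    and lsc: "\<And>X x m. (\<And>n. X n \<in> D) \<Longrightarrow> X \<longlonglongrightarrow> x \<Longrightarrow> (\<lambda>n. F (X n)) \<longlonglongrightarrow> m \<Longrightarrow> x \<in> D \<and> F x \<le> m"
  shows "\<exists>x\<in>D. \<forall>y\<in>D. F x \<le> F y"
proof -
  define m where "m = (INF x\<in>D. F x)"
  have bb: "bdd_below (F ` D)" using bdd by (auto simp: bdd_below_def)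
  have m_le: "m \<le> F x" if "x \<in> D" for x
    unfolding m_def by (rule cINF_lower[OF bb that])
  have "\<exists>x. x \<in> D \<and> F x < m + 1 / Suc n" for n
  proof -
    have "m < m + 1 / Suc n" by simp
    then show ?thesis
      using cINF_less_iff[OF \<open>D \<noteq> {}\<close> bb] unfolding m_def by blast
  qed
  then obtain X where X: "\<And>n. X n \<in> D" "\<And>n. F (X n) < m + 1 / Suc n" by metis
  have "Cauchy X"
  proof (rule metric_CauchyI)
    fix e :: real assume "e > 0"
    then have "c * e\<^sup>2 > 0" using \<open>c > 0\<close> by simp
    then obtain N where N: "1 / Suc N < c * e\<^sup>2" using nat_approx_posE by metis
    have "dist (X i) (X j) < e" if "i \<ge> N" "j \<ge> N" for i j
    proof -
      define d where "d = 1 / real (Suc N)"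
      have small: "F (X k) < m + d" if "k \<ge> N" for k
      proof -
        have "1 / real (Suc k) \<le> 1 / real (Suc N)" using that by (simp add: field_simps)
        with X(2)[of k] show ?thesis unfolding d_def by linarith
      qed
      have *: "q < r" if "a + q \<le> (u + v) / 2" "m \<le> a" "u < m + d" "v < m + d" "d < r" for a q r u v
        using that by argo
      have "c * (norm (X i - X j))\<^sup>2 < c * e\<^sup>2"
        by (rule *[OF mid(2)[OF X(1)[of i] X(1)[of j]] m_le[OF mid(1)[OF X(1)[of i] X(1)[of j]]]
          small[OF that(1)] small[OF that(2)] N[folded d_def]])
      then show ?thesis
        using \<open>c > 0\<close> \<open>e > 0\<close> by (simp add: dist_norm power2_less_imp_less)
    qed
    then show "\<exists>M. \<forall>i\<ge>M. \<forall>j\<ge>M. dist (X i) (X j) < e" by blast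
  qed
  then obtain x where "X \<longlonglongrightarrow> x" using Cauchy_convergent convergent_def by blast
  moreover have "(\<lambda>n. F (X n)) \<longlonglongrightarrow> m"
  proof (rule tendsto_sandwich[where f = "\<lambda>_. m" and h = "\<lambda>n. m + 1 / Suc n"])
    show "(\<lambda>n. m + 1 / Suc n) \<longlonglongrightarrow> m"
      using tendsto_add[OF tendsto_const LIMSEQ_inverse_real_of_nat, of m]
      by (simp add: field_simps inverse_eq_divide)
    show "\<forall>\<^sub>F n in sequentially. m \<le> F (X n)" using m_le X(1) by simp
    show "\<forall>\<^sub>F n in sequentially. F (X n) \<le> m + 1 / Suc n"
      using X(2) by (simp add: less_imp_le)
  qed simp
  ultimately have "x \<in> D" "F x \<le> m" using lsc[of X x m] X(1) by auto
  then show ?thesis using m_le by force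
qed

text \<open>This is the parallelogram law for \<open>a - x\<close> and \<open>a - y\<close>; it
  supplies the midpoint gain for squared norms.\<close>

lemma norm_midpoint_sq:
  fixes x y a :: "'a::real_inner"
  shows "(norm (a - midpoint x y))\<^sup>2 + (norm (x - y))\<^sup>2 / 4
    = ((norm (a - x))\<^sup>2 + (norm (a - y))\<^sup>2) / 2"
  unfolding midpoint_def power2_norm_eq_inner
  by (simp add: algebra_simps inner_commute) argo

lemma min_norm_exists:
  fixes C :: "'a::{real_inner, complete_space} set"
  assumes "closed C" "convex C" "C \<noteq> {}"
  shows "\<exists>x\<in>C. \<forall>y\<in>C. (norm x)\<^sup>2 \<le> (norm y)\<^sup>2"
proof (rule uniformly_convex_attains_inf[where b = 0 and c = "1/4"])
  fix x y assume "x \<in> C" "y \<in> C"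
  then show "midpoint x y \<in> C"
    using convexD_alt[OF assms(2), of x y "1/2"] by (simp add: midpoint_def algebra_simps)
  show "(norm (midpoint x y))\<^sup>2 + 1/4 * (norm (x - y))\<^sup>2 \<le> ((norm x)\<^sup>2 + (norm y)\<^sup>2) / 2"
    using norm_midpoint_sq[of 0 x y] by simp
next
  fix X x m assume *: "\<And>n. X n \<in> C" "X \<longlonglongrightarrow> x" "(\<lambda>n. (norm (X n))\<^sup>2) \<longlonglongrightarrow> m"
  have "(\<lambda>n. (norm (X n))\<^sup>2) \<longlonglongrightarrow> (norm x)\<^sup>2" by (intro tendsto_intros *)
  then have "(norm x)\<^sup>2 = m" using *(3) LIMSEQ_unique by blast
  moreover have "x \<in> C" using assms(1) * closed_sequentially by blast
  ultimately show "x \<in> C \<and> (norm x)\<^sup>2 \<le> m" by simp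
qed (use assms in auto)

text \<open>Split at an index after which the tail of \<open>a\<close> is small. The fixed head
  vanishes after division by \<open>b n\<close>; in the tail \<open>b (Suc k) \<le> b n\<close> by
  monotonicity.\<close>

lemma Kronecker_tendsto:
  fixes a b :: "nat \<Rightarrow> real"
  assumes "summable a" "\<And>n. a n \<ge> 0" "\<And>n. b n > 0" "mono b" "filterlim b at_top sequentially"
  shows "(\<lambda>n. (\<Sum>k<n. a k * b (Suc k)) / b n) \<longlonglongrightarrow> 0"
proof (rule LIMSEQ_I)
  fix e :: real assume "e > 0"
  then obtain N where N: "\<And>n. n \<ge> N \<Longrightarrow> norm (sum a {N..<n}) < e/2"
    using assms(1)[unfolded summable_Cauchy] by (metis half_gt_zero order_refl)
  define S where "S = (\<Sum>k<N. a k * b (Suc k))"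
  have "(\<lambda>n. S / b n) \<longlonglongrightarrow> 0"
    by (rule tendsto_divide_0[OF tendsto_const filterlim_at_top_imp_at_infinity[OF assms(5)]])
  then have "\<forall>\<^sub>F n in sequentially. S / b n < e/2"
    using \<open>e > 0\<close> by (intro order_tendstoD) auto
  then obtain M where M: "\<And>n. n \<ge> M \<Longrightarrow> S / b n < e/2"
    by (auto simp: eventually_sequentially)
  have "norm ((\<Sum>k<n. a k * b (Suc k)) / b n - 0) < e" if "n \<ge> max N M" for n
  proof -
    have "(\<Sum>k<n. a k * b (Suc k)) = S + (\<Sum>k=N..<n. a k * b (Suc k))"
      unfolding S_def using that
      by (simp add: lessThan_atLeast0 sum.atLeastLessThan_concat)
    also have "(\<Sum>k=N..<n. a k * b (Suc k)) \<le> (\<Sum>k=N..<n. a k * b n)"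
      by (intro sum_mono mult_left_mono) (use assms(2,4) in \<open>auto simp: mono_def\<close>)
    also have "\<dots> = sum a {N..<n} * b n" by (simp add: sum_distrib_right)
    finally have "(\<Sum>k<n. a k * b (Suc k)) / b n \<le> S / b n + sum a {N..<n}"
      using assms(3)[of n] by (simp add: field_simps)
    moreover have "0 \<le> (\<Sum>k<n. a k * b (Suc k)) / b n"
      using assms(2,3) by (intro divide_nonneg_pos sum_nonneg mult_nonneg_nonneg) (auto intro: less_imp_le)
    ultimately have *: "0 \<le> (\<Sum>k<n. a k * b (Suc k)) / b n"
        "(\<Sum>k<n. a k * b (Suc k)) / b n \<le> S / b n + sum a {N..<n}" by blast+
    have "\<bar>(\<Sum>k<n. a k * b (Suc k)) / b n\<bar> < e"
    proof -
      have "\<bar>sum a {N..<n}\<bar> < e / 2" "S / b n < e / 2"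
        using N[of n] M[of n] that by auto
      with * show ?thesis by linarith
    qed
    then show ?thesis by simp
  qed
  then show "\<exists>no. \<forall>n\<ge>no. norm ((\<Sum>k<n. a k * b (Suc k)) / b n - 0) < e" by blast
qed

section \<open>Closed proper convex functions and proximal points\<close>

locale closed_proper_convex =
  fixes h :: "'a::{real_inner, complete_space} \<Rightarrow> ereal"
  assumes proper: "proper_fun h" and closed: "closed_fun h" and convex: "convex_fun h"
begin

definition edom :: "'a set" where "edom = {x. h x \<noteq> \<infinity>}"

text \<open>Off \<open>edom\<close> this has the default value 0, so facts about it carry membership
  in \<open>edom\<close>.\<close>

definition hr :: "'a \<Rightarrow> real" where "hr x = real_of_ereal (h x)"

lemma h_eq: "x \<in> edom \<Longrightarrow> h x = ereal (hr x)"
  using proper unfolding edom_def hr_def proper_fun_def by (cases "h x") auto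

lemma h_eq_top: "x \<notin> edom \<Longrightarrow> h x = \<infinity>"
  by (simp add: edom_def)

lemma edom_nonempty: "edom \<noteq> {}"
  using proper unfolding edom_def proper_fun_def by auto

lemma h_le_ereal_iff: "h x \<le> ereal c \<longleftrightarrow> x \<in> edom \<and> hr x \<le> c"
  using h_eq h_eq_top by (cases "x \<in> edom") auto

lemma hr_convex:
  assumes "x \<in> edom" "y \<in> edom" "0 \<le> t" "t \<le> 1"
  shows "(1 - t) *\<^sub>R x + t *\<^sub>R y \<in> edom"
    and "hr ((1 - t) *\<^sub>R x + t *\<^sub>R y) \<le> (1 - t) * hr x + t * hr y"
proof -
  have "h ((1 - t) *\<^sub>R x + t *\<^sub>R y) \<le> ereal (1 - t) * h x + ereal t * h y"
    using convex assms unfolding convex_fun_def by auto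
  also have "\<dots> = ereal ((1 - t) * hr x + t * hr y)"
    using assms by (simp add: h_eq)
  finally show "(1 - t) *\<^sub>R x + t *\<^sub>R y \<in> edom"
    and "hr ((1 - t) *\<^sub>R x + t *\<^sub>R y) \<le> (1 - t) * hr x + t * hr y"
    unfolding h_le_ereal_iff by auto
qed

lemma hr_lsc:
  assumes "\<And>n. X n \<in> edom" "X \<longlonglongrightarrow> x" "c \<longlonglongrightarrow> c'" "\<And>n. hr (X n) \<le> c n"
  shows "x \<in> edom \<and> hr x \<le> c'"
  using closed_fun_sequential_le[OF closed assms(2,3)] assms(1,4) h_le_ereal_iff by blast

lemma subdifferential_iff:
  "s \<in> subdifferential h x \<longleftrightarrow> x \<in> edom \<and> (\<forall>y\<in>edom. hr x + s \<bullet> (y - x) \<le> hr y)"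
proof (cases "x \<in> edom")
  case True
  have "h x + ereal (s \<bullet> (y - x)) \<le> h y \<longleftrightarrow> (y \<in> edom \<longrightarrow> hr x + s \<bullet> (y - x) \<le> hr y)" for y
    using True by (cases "y \<in> edom") (simp_all add: h_eq h_eq_top)
  with True show ?thesis unfolding subdifferential_def by auto
next
  case False
  obtain y where "y \<in> edom" using edom_nonempty by blast
  with False have "\<not> h x + ereal (s \<bullet> (y - x)) \<le> h y"
    by (simp add: h_eq h_eq_top)
  with False show ?thesis unfolding subdifferential_def by blast
qed

lemma conjugate_le_iff: "conjugate h s \<le> ereal c \<longleftrightarrow> (\<forall>x\<in>edom. s \<bullet> x - hr x \<le> c)"
proof -
  have "ereal (s \<bullet> x) - h x \<le> ereal c \<longleftrightarrow> (x \<in> edom \<longrightarrow> s \<bullet> x - hr x \<le> c)" for x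
    by (cases "x \<in> edom") (simp_all add: h_eq h_eq_top)
  then show ?thesis unfolding conjugate_def SUP_le_iff by auto
qed

lemma conjugate_finiteE:
  assumes "conjugate h s \<noteq> \<infinity>"
  obtains c where "conjugate h s \<le> ereal c"
  using assms by (cases "conjugate h s") auto

lemma less_conjugate_iff: "a < conjugate h s \<longleftrightarrow> (\<exists>x\<in>edom. a < ereal (s \<bullet> x - hr x))"
proof -
  have "a < ereal (s \<bullet> x) - h x \<longleftrightarrow> (x \<in> edom \<and> a < ereal (s \<bullet> x - hr x))" for x
    by (cases "x \<in> edom") (simp_all add: h_eq h_eq_top)
  then show ?thesis unfolding conjugate_def less_SUP_iff by auto
qed

text \<open>Lower semicontinuity bounds \<open>h\<close> from below near a point of the domain; convexity spreads
  the bound to a minorant that is affine in the distance, so no separation theorem is needed.\<close>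
lemma hr_lower_bound:
  assumes "x0 \<in> edom"
  shows "\<exists>A B. \<forall>y\<in>edom. A - B * norm (y - x0) \<le> hr y"
proof -
  have "ereal (hr x0 - 1) < h x0" using assms h_eq by simp
  then have "ereal (hr x0 - 1) < Liminf (at x0) h"
    using closed unfolding closed_fun_def by (metis order_less_le_trans)
  then have "\<forall>\<^sub>F y in at x0. ereal (hr x0 - 1) < h y" by (rule less_LiminfD)
  then obtain d where d: "d > 0" "\<And>y. y \<noteq> x0 \<Longrightarrow> dist y x0 < d \<Longrightarrow> ereal (hr x0 - 1) < h y"
    unfolding eventually_at by auto
  have near: "hr x0 - 1 \<le> hr y" if "y \<in> edom" "norm (y - x0) < d" for y
    using d(2)[of y] that h_eq[of y] by (cases "y = x0") (auto simp: dist_norm)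
  define r where "r = d / 2"
  have r: "r > 0" "r < d" using d(1) by (auto simp: r_def)
  have "hr x0 - 1 - (1 / r) * norm (y - x0) \<le> hr y" if y: "y \<in> edom" for y
  proof (cases "norm (y - x0) < d")
    case True
    then show ?thesis using near[OF y] r(1)
      by (smt (verit) divide_nonneg_pos mult_nonneg_nonneg norm_ge_zero)
  next
    case False
    \<comment> \<open>This factor moves \<open>y\<close> along the segment onto the sphere of radius
      \<open>r\<close> about \<open>x0\<close>, where the local bound applies.\<close>
    define t where "t = r / norm (y - x0)"
    have n: "norm (y - x0) > 0" using False d(1) by linarith
    have t: "0 < t" "t \<le> 1" using False r n by (auto simp: t_def)
    have eq: "(1 - t) *\<^sub>R x0 + t *\<^sub>R y - x0 = t *\<^sub>R (y - x0)" by (simp add: algebra_simps)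
    have "norm ((1 - t) *\<^sub>R x0 + t *\<^sub>R y - x0) = r"
      unfolding eq using t n r by (simp add: t_def)
    then have "hr x0 - 1 \<le> (1 - t) * hr x0 + t * hr y"
      using near[of "(1 - t) *\<^sub>R x0 + t *\<^sub>R y"] hr_convex[OF assms y, of t] t r by auto
    then have "t * (hr x0 - 1 / t) \<le> t * hr y" using t by (simp add: algebra_simps)
    then have "hr x0 - 1 / t \<le> hr y" using t(1) by simp
    then show ?thesis by (simp add: t_def)
  qed
  then show ?thesis by blast
qed

text \<open>\<open>prox\<close> is a choice, so a minimizer must be exhibited first. The objective
  is bounded below because the quadratic beats the minorant from \<open>hr_lower_bound\<close>, and
  the quadratic provides the midpoint gain.\<close>

lemma prox_minimizes:
  assumes "\<gamma> > 0"
  shows "prox \<gamma> h x \<in> edom"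
    and "y \<in> edom \<Longrightarrow> hr (prox \<gamma> h x) + (norm (x - prox \<gamma> h x))\<^sup>2 / (2 * \<gamma>)
      \<le> hr y + (norm (x - y))\<^sup>2 / (2 * \<gamma>)"
proof -
  define F where "F y = hr y + (norm (x - y))\<^sup>2 / (2 * \<gamma>)" for y
  have "\<exists>p\<in>edom. \<forall>y\<in>edom. F p \<le> F y"
  proof -
    obtain x0 where x0: "x0 \<in> edom" using edom_nonempty by blast
    obtain A B where AB: "\<And>y. y \<in> edom \<Longrightarrow> A - B * norm (y - x0) \<le> hr y"
      using hr_lower_bound[OF x0] by blast
    \<comment> \<open>The last term is the minimum over \<open>n\<close> of
      \<open>n\<^sup>2 / (2 * \<gamma>) - \<bar>B\<bar> * n\<close>, attained at
      \<open>n = \<bar>B\<bar> * \<gamma>\<close>.\<close>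
    define b where "b = A - \<bar>B\<bar> * norm (x - x0) - B\<^sup>2 * \<gamma> / 2"
    have low: "b \<le> F y" if "y \<in> edom" for y
    proof -
      define n where "n = norm (x - y)"
      have "norm (y - x0) \<le> n + norm (x - x0)"
        unfolding n_def using norm_triangle_ineq[of "y - x" "x - x0"] by (simp add: norm_minus_commute)
      then have "\<bar>B\<bar> * norm (y - x0) \<le> \<bar>B\<bar> * (n + norm (x - x0))" by (rule mult_left_mono) simp
      moreover have "B * norm (y - x0) \<le> \<bar>B\<bar> * norm (y - x0)" by (simp add: mult_right_mono)
      moreover have "\<bar>B\<bar> * n \<le> n\<^sup>2 / (2 * \<gamma>) + B\<^sup>2 * \<gamma> / 2"
      proof -
        have "n\<^sup>2 / (2 * \<gamma>) + B\<^sup>2 * \<gamma> / 2 - \<bar>B\<bar> * n = (n - \<bar>B\<bar> * \<gamma>)\<^sup>2 / (2 * \<gamma>)"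
          using assms by (simp add: power2_diff power_mult_distrib field_simps) (simp add: power2_eq_square)
        moreover have "\<dots> \<ge> 0" using assms by simp
        ultimately show ?thesis by linarith
      qed
      ultimately show ?thesis
        using AB[OF that] unfolding F_def b_def n_def[symmetric] by (simp add: algebra_simps)
    qed
    have mid: "midpoint y z \<in> edom"
      "F (midpoint y z) + 1 / (8 * \<gamma>) * (norm (y - z))\<^sup>2 \<le> (F y + F z) / 2"
      if "y \<in> edom" "z \<in> edom" for y z
    proof -
      have m: "midpoint y z = (1 - 1/2) *\<^sub>R y + (1/2) *\<^sub>R z"
        by (simp add: midpoint_def algebra_simps)
      show "midpoint y z \<in> edom" unfolding m by (rule hr_convex) (use that in auto)
      have "hr (midpoint y z) \<le> (hr y + hr z) / 2"
        using hr_convex(2)[OF that, of "1/2"] unfolding m by (simp add: field_simps)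
      moreover have "(norm (x - midpoint y z))\<^sup>2 / (2 * \<gamma>) + 1 / (8 * \<gamma>) * (norm (y - z))\<^sup>2
          = ((norm (x - y))\<^sup>2 / (2 * \<gamma>) + (norm (x - z))\<^sup>2 / (2 * \<gamma>)) / 2"
      proof -
        have "(norm (x - midpoint y z))\<^sup>2 / (2 * \<gamma>) + 1 / (8 * \<gamma>) * (norm (y - z))\<^sup>2
          = ((norm (x - midpoint y z))\<^sup>2 + (norm (y - z))\<^sup>2 / 4) / (2 * \<gamma>)"
          using assms by (simp add: field_simps)
        also have "\<dots> = ((norm (x - y))\<^sup>2 / (2 * \<gamma>) + (norm (x - z))\<^sup>2 / (2 * \<gamma>)) / 2"
          unfolding norm_midpoint_sq using assms by (simp add: field_simps)
        finally show ?thesis .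
      qed
      ultimately show "F (midpoint y z) + 1 / (8 * \<gamma>) * (norm (y - z))\<^sup>2 \<le> (F y + F z) / 2"
        unfolding F_def by argo
    qed
    have lsc: "y \<in> edom \<and> F y \<le> m"
      if "\<And>n. X n \<in> edom" "X \<longlonglongrightarrow> y" "(\<lambda>n. F (X n)) \<longlonglongrightarrow> m" for X y m
    proof -
      have "(\<lambda>n. F (X n) - (norm (x - X n))\<^sup>2 / (2 * \<gamma>)) \<longlonglongrightarrow> m - (norm (x - y))\<^sup>2 / (2 * \<gamma>)"
        using assms by (intro tendsto_intros that) auto
      then show ?thesis
        using hr_lsc[OF that(1,2)] by (force simp: F_def algebra_simps)
    qed
    show ?thesis
      by (rule uniformly_convex_attains_inf[OF edom_nonempty low _ mid lsc]) (use assms in auto)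
  qed
  then obtain p where p: "p \<in> edom" "\<And>y. y \<in> edom \<Longrightarrow> F p \<le> F y" by blast
  let ?f = "\<lambda>y. h y + ereal ((norm (x - y))\<^sup>2 / (2 * \<gamma>))"
  have f: "?f y = (if y \<in> edom then ereal (F y) else \<infinity>)" for y
    by (simp add: h_eq h_eq_top F_def)
  have "is_arg_min ?f (\<lambda>y. y \<in> UNIV) p"
    unfolding is_arg_min_def f using p by (auto simp: not_less)
  then have "is_arg_min ?f (\<lambda>y. y \<in> UNIV) (prox \<gamma> h x)"
    unfolding prox_def arg_min_on_def arg_min_def by (rule someI)
  then have *: "\<not> ?f y < ?f (prox \<gamma> h x)" for y
    unfolding is_arg_min_def by simp
  show 1: "prox \<gamma> h x \<in> edom"
    using *[of p] p(1) unfolding f by (auto split: if_splits)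
  show "hr (prox \<gamma> h x) + (norm (x - prox \<gamma> h x))\<^sup>2 / (2 * \<gamma>)
      \<le> hr y + (norm (x - y))\<^sup>2 / (2 * \<gamma>)" if "y \<in> edom"
    using *[of y] 1 that unfolding f by (simp add: F_def not_less)
qed

text \<open>Minimality is tested on the segment from the proximal point to \<open>y\<close>. After
  division by \<open>t\<close> the quadratic remainder is \<open>t * N\<close>, which vanishes as
  \<open>t\<close> decreases to 0.\<close>

lemma prox_subgradient:
  assumes "\<gamma> > 0"
  shows "(x - prox \<gamma> h x) /\<^sub>R \<gamma> \<in> subdifferential h (prox \<gamma> h x)"
proof -
  define p where "p = prox \<gamma> h x"
  have p: "p \<in> edom" "\<And>y. y \<in> edom \<Longrightarrow> hr p + (norm (x - p))\<^sup>2 / (2 * \<gamma>) \<le> hr y + (norm (x - y))\<^sup>2 / (2 * \<gamma>)"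
    using prox_minimizes[OF assms] unfolding p_def by auto
  have "hr p + ((x - p) /\<^sub>R \<gamma>) \<bullet> (y - p) \<le> hr y" if y: "y \<in> edom" for y
  proof -
    define N where "N = (norm (y - p))\<^sup>2 / (2 * \<gamma>)"
    define I where "I = ((x - p) /\<^sub>R \<gamma>) \<bullet> (y - p)"
    have I_eq: "I = ((x - p) \<bullet> (y - p)) / \<gamma>"
      by (simp add: I_def divide_inverse_commute)
    have ineq: "hr p + I \<le> hr y + t * N" if t: "0 < t" "t \<le> 1" for t
    proof -
      let ?z = "(1 - t) *\<^sub>R p + t *\<^sub>R y"
      have "(norm (x - ?z))\<^sup>2 = (norm (x - p - t *\<^sub>R (y - p)))\<^sup>2"
        by (simp add: algebra_simps)
      also have "\<dots> = (norm (x - p))\<^sup>2 - 2 * t * ((x - p) \<bullet> (y - p)) + t\<^sup>2 * (norm (y - p))\<^sup>2"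
        unfolding power2_norm_eq_inner
        by (simp add: inner_diff_left[of "x - p"] inner_diff_right[of _ "x - p"] inner_commute power2_eq_square)
      finally have "(norm (x - ?z))\<^sup>2 / (2 * \<gamma>) = (norm (x - p))\<^sup>2 / (2 * \<gamma>) - t * I + t\<^sup>2 * N"
        using assms by (simp add: I_eq N_def field_simps)
      moreover have "hr p + (norm (x - p))\<^sup>2 / (2 * \<gamma>) \<le> (1 - t) * hr p + t * hr y + (norm (x - ?z))\<^sup>2 / (2 * \<gamma>)"
        using p(2)[of ?z] hr_convex[OF p(1) y, of t] t by auto
      ultimately have "t * (hr p + I) \<le> t * (hr y + t * N)"
        by (simp add: algebra_simps power2_eq_square)
      then show ?thesis using t(1) by simp
    qed
    have "((\<lambda>t. hr y + t * N) \<longlongrightarrow> hr y + 0 * N) (at_right 0)"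
      by (intro tendsto_intros)
    moreover have "\<forall>\<^sub>F t in at_right 0. hr p + I \<le> hr y + t * N"
      by (rule eventually_mono[OF eventually_at_right_real[of 0 1]]) (auto intro: ineq)
    ultimately have "hr p + I \<le> hr y + 0 * N"
      by (rule tendsto_lowerbound) simp
    then show ?thesis by (simp add: I_def)
  qed
  then show ?thesis using p(1) unfolding subdifferential_iff p_def by blast
qed

text \<open>Any point of the domain of the conjugate is approximated by the residuals of
  proximal points with large step sizes.\<close>
lemma conjugate_finite_in_closure:
  assumes "conjugate h z \<noteq> \<infinity>"
  shows "z \<in> closure (range_subdifferential h)"
proof -
  obtain c where "conjugate h z \<le> ereal c"
    using assms by (rule conjugate_finiteE)
  then have c: "\<And>x. x \<in> edom \<Longrightarrow> z \<bullet> x - hr x \<le> c" by (simp add: conjugate_le_iff)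
  obtain u where u: "u \<in> edom" using edom_nonempty by blast
  define \<delta> where "\<delta> = hr u + c - z \<bullet> u"
  show ?thesis unfolding closure_approachable
  proof (intro allI impI)
    fix e :: real assume e: "e > 0"
    \<comment> \<open>Chosen so that \<open>\<gamma> * (norm (g - z))\<^sup>2 \<le> \<delta>\<close>
      forces \<open>norm (g - z) < e\<close>.\<close>
    define \<gamma> where "\<gamma> = (\<bar>\<delta>\<bar> + 1) / e\<^sup>2"
    have \<gamma>: "\<gamma> > 0" using e by (simp add: \<gamma>_def)
    define p where "p = prox \<gamma> h (u + \<gamma> *\<^sub>R z)"
    define g where "g = (u + \<gamma> *\<^sub>R z - p) /\<^sub>R \<gamma>"
    have g: "g \<in> subdifferential h p" unfolding g_def p_def by (rule prox_subgradient[OF \<gamma>])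
    have up: "u - p = \<gamma> *\<^sub>R (g - z)" using \<gamma> by (simp add: g_def algebra_simps)
    \<comment> \<open>Add the subgradient inequality at \<open>u\<close> to the minorant
      \<open>hr p \<ge> z \<bullet> p - c\<close>.\<close>
    have "(g - z) \<bullet> (u - p) \<le> \<delta>"
      using g u c[of p] unfolding subdifferential_iff \<delta>_def by (force simp: inner_simps)
    then have "\<gamma> * (norm (g - z))\<^sup>2 \<le> \<delta>" unfolding up by (simp add: power2_norm_eq_inner)
    also have "\<delta> < \<gamma> * e\<^sup>2" using e by (simp add: \<gamma>_def)
    finally have "norm (g - z) < e" using \<gamma> e by (simp add: power2_less_imp_less)
    moreover have "g \<in> range_subdifferential h" using g unfolding range_subdifferential_def by blast
    ultimately show "\<exists>y\<in>range_subdifferential h. dist y z < e" by (auto simp: dist_norm)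
  qed
qed

section \<open>Domain of the conjugate and the element of minimal norm\<close>

lemma conjugate_le_of_subgradient:
  assumes "g \<in> subdifferential h p"
  shows "conjugate h g \<le> ereal (g \<bullet> p - hr p)"
  using assms unfolding conjugate_le_iff subdifferential_iff by (force simp: inner_simps)

text \<open>The range of the subdifferential need not be convex; convexity of its closure is
  obtained from this set, which has the same closure.\<close>

lemma convex_conjugate_finite: "convex {z. conjugate h z \<noteq> \<infinity>}"
  unfolding convex_alt
proof safe
  fix z w and t :: real
  assume *: "conjugate h z \<noteq> \<infinity>" "conjugate h w \<noteq> \<infinity>" "0 \<le> t" "t \<le> 1"
    and inf: "conjugate h ((1 - t) *\<^sub>R z + t *\<^sub>R w) = \<infinity>"
  obtain c d where cd: "conjugate h z \<le> ereal c" "conjugate h w \<le> ereal d"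
    using *(1,2) by (meson conjugate_finiteE)
  have "((1 - t) *\<^sub>R z + t *\<^sub>R w) \<bullet> x - hr x \<le> (1 - t) * c + t * d" if "x \<in> edom" for x
  proof -
    have "(1 - t) * (z \<bullet> x - hr x) + t * (w \<bullet> x - hr x) \<le> (1 - t) * c + t * d"
      by (intro add_mono mult_left_mono) (use cd that * in \<open>auto simp: conjugate_le_iff\<close>)
    then show ?thesis by (simp add: inner_simps algebra_simps)
  qed
  then have "conjugate h ((1 - t) *\<^sub>R z + t *\<^sub>R w) \<le> ereal ((1 - t) * c + t * d)"
    by (simp add: conjugate_le_iff)
  with inf show False by simp
qed

lemma closure_range_subdifferential:
  "closure (range_subdifferential h) = closure {z. conjugate h z \<noteq> \<infinity>}"
proof (rule antisym)
  have "range_subdifferential h \<subseteq> {z. conjugate h z \<noteq> \<infinity>}"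
    unfolding range_subdifferential_def using conjugate_le_of_subgradient by fastforce
  then show "closure (range_subdifferential h) \<subseteq> closure {z. conjugate h z \<noteq> \<infinity>}"
    by (rule closure_mono)
  show "closure {z. conjugate h z \<noteq> \<infinity>} \<subseteq> closure (range_subdifferential h)"
    using conjugate_finite_in_closure by (intro closure_minimal) auto
qed

lemma range_subdifferential_nonempty: "range_subdifferential h \<noteq> {}"
  using prox_subgradient[of 1] unfolding range_subdifferential_def by fastforce

text \<open>The second claim is the variational inequality for the projection of the origin onto a
  closed convex set.\<close>

lemma min_norm_range_subdifferential:
  assumes "sbar = arg_min_on (\<lambda>v. (norm v)\<^sup>2) (closure (range_subdifferential h))"
  shows "sbar \<in> closure (range_subdifferential h)"
    and "g \<in> range_subdifferential h \<Longrightarrow> 0 \<le> sbar \<bullet> (g - sbar)"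
proof -
  let ?C = "closure (range_subdifferential h)"
  have C: "convex ?C" "closed ?C" "?C \<noteq> {}"
    using convex_closure[OF convex_conjugate_finite] closure_range_subdifferential
      range_subdifferential_nonempty by auto
  obtain x where "x \<in> ?C" "\<forall>y\<in>?C. (norm x)\<^sup>2 \<le> (norm y)\<^sup>2"
    using min_norm_exists[OF C(2,1,3)] by blast
  then have "is_arg_min (\<lambda>v. (norm v)\<^sup>2) (\<lambda>v. v \<in> ?C) x"
    by (auto simp: is_arg_min_def not_less)
  then have "is_arg_min (\<lambda>v. (norm v)\<^sup>2) (\<lambda>v. v \<in> ?C) sbar"
    unfolding assms arg_min_on_def arg_min_def by (rule someI)
  then have s: "sbar \<in> ?C" "\<forall>y\<in>?C. dist 0 sbar \<le> dist 0 y"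
    by (auto simp: is_arg_min_def not_less intro: power2_le_imp_le)
  show "sbar \<in> ?C" by (rule s)
  show "0 \<le> sbar \<bullet> (g - sbar)" if "g \<in> range_subdifferential h"
    using any_closest_point_dot[OF C(1,2) s(1) _ s(2), of g] that closure_subset[of "range_subdifferential h"] by auto
qed

end

section \<open>The inexact proximal point algorithm\<close>

locale inexact_proximal_run = closed_proper_convex h
  for h :: "'a::{real_inner, complete_space} \<Rightarrow> ereal" +
  fixes \<gamma> \<epsilon> :: "nat \<Rightarrow> real" and lstar sstar l s :: "nat \<Rightarrow> 'a"
  assumes conditions: "error_step_conditions \<gamma> \<epsilon>"
    and run: "ippa h \<gamma> \<epsilon> lstar sstar l s"
begin

text \<open>Indices are shifted: \<open>p n\<close>, \<open>g n\<close> and \<open>\<eta> n\<close> carry index \<open>n + 1\<close> in the algorithm, and \<open>a\<close>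
  is the summand of (A4).\<close>
definition p :: "nat \<Rightarrow> 'a" where "p n = lstar (Suc n)"
definition g :: "nat \<Rightarrow> 'a" where "g n = sstar (Suc n)"
definition \<eta> :: "nat \<Rightarrow> real" where "\<eta> n = \<epsilon> (Suc n)"
definition e :: "nat \<Rightarrow> 'a" where "e n = l (Suc n) - p n"
definition G :: "nat \<Rightarrow> real" where "G n = (\<Sum>i=0..n. \<gamma> i)"
definition a :: "nat \<Rightarrow> real" where "a n = \<eta> n / \<gamma> (Suc n) * G n"

lemma \<gamma>_pos: "\<gamma> n > 0" and \<eta>_nonneg: "\<eta> n \<ge> 0"
  using conditions unfolding error_step_conditions_def \<eta>_def by auto

lemma summable_\<eta>: "summable \<eta>"
  using conditions unfolding error_step_conditions_def \<eta>_def by simp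

lemma G_Suc: "G (Suc n) = G n + \<gamma> (Suc n)"
  by (simp add: G_def)

lemma G_ge: "\<gamma> 0 \<le> G n"
  by (induction n) (simp_all add: G_def[of 0] G_Suc add_increasing2 less_imp_le[OF \<gamma>_pos])

lemma G_pos: "G n > 0"
  using G_ge[of n] \<gamma>_pos[of 0] by linarith

lemma mono_G: "mono G"
  by (intro incseq_SucI) (simp add: G_Suc less_imp_le[OF \<gamma>_pos])

lemma G_at_top: "filterlim G at_top sequentially"
  using conditions unfolding error_step_conditions_def G_def[abs_def] by simp

lemma summable_a: "summable a"
proof -
  have "(\<Sum>i=1..Suc k. \<gamma> (i - 1)) = G k" for k
    unfolding G_def One_nat_def sum.shift_bounds_cl_Suc_ivl by simp
  moreover have "summable (\<lambda>k. \<epsilon> (Suc k) / \<gamma> (Suc k) * (\<Sum>i=1..Suc k. \<gamma> (i - 1)))"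
    using conditions unfolding error_step_conditions_def by blast
  ultimately show ?thesis unfolding a_def[abs_def] \<eta>_def by simp
qed

lemma a_nonneg: "a n \<ge> 0"
  unfolding a_def using \<eta>_nonneg \<gamma>_pos G_pos by (simp add: less_imp_le)

text \<open>Puts an error weighted by \<open>G n\<close> into the form required by
  \<open>Kronecker_tendsto\<close>.\<close>

lemma a_le: "G n * \<eta> n \<le> a n * G (Suc n)"
proof -
  have "G n * \<eta> n = a n * \<gamma> (Suc n)" using \<gamma>_pos[of "Suc n"] by (simp add: a_def)
  also have "\<dots> \<le> a n * G (Suc n)"
    using G_pos[of n] by (intro mult_left_mono a_nonneg) (simp add: G_Suc)
  finally show ?thesis .
qed

section \<open>The perturbed proximal step\<close>

lemma norm_e: "norm (e n) \<le> \<eta> n"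
  using run unfolding ippa_def e_def p_def \<eta>_def by blast

lemma g_subgradient: "g n \<in> subdifferential h (p n)"
  using run prox_subgradient[OF \<gamma>_pos[of n], of "l n"] unfolding ippa_def g_def p_def by metis

lemma p_edom: "p n \<in> edom"
  using g_subgradient subdifferential_iff by blast

lemma subgradient_ineq: "y \<in> edom \<Longrightarrow> hr (p n) + g n \<bullet> (y - p n) \<le> hr y"
  using g_subgradient subdifferential_iff by blast

lemma l_eq: "l n = p n + \<gamma> n *\<^sub>R g n"
proof -
  have "g n = (l n - p n) /\<^sub>R \<gamma> n" using run unfolding ippa_def g_def p_def by blast
  then show ?thesis using \<gamma>_pos[of n] by simp
qed

lemma p_Suc: "p n + e n = p (Suc n) + \<gamma> (Suc n) *\<^sub>R g (Suc n)"
  using l_eq[of "Suc n"] by (simp add: e_def)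

text \<open>Monotonicity of the subdifferential makes exact residuals shrink in norm; the error
  enters only through the scaled vector \<open>r\<close>.\<close>

lemma norm_g_sq_step: "(norm (g (Suc n)))\<^sup>2 \<le> (norm (g n))\<^sup>2 + (\<eta> n / \<gamma> (Suc n))\<^sup>2"
proof -
  define r where "r = e n /\<^sub>R \<gamma> (Suc n)"
  have r: "norm r \<le> \<eta> n / \<gamma> (Suc n)"
    using norm_e[of n] \<gamma>_pos[of "Suc n"] by (simp add: r_def field_simps)
  have "p (Suc n) - p n = \<gamma> (Suc n) *\<^sub>R (r - g (Suc n))"
    using p_Suc[of n] \<gamma>_pos[of "Suc n"] by (simp add: r_def algebra_simps)
  moreover have "0 \<le> (g (Suc n) - g n) \<bullet> (p (Suc n) - p n)"
    using subgradient_ineq[OF p_edom, of n "Suc n"] subgradient_ineq[OF p_edom, of "Suc n" n]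
    by (simp add: inner_simps)
  ultimately have "0 \<le> (g (Suc n) - g n) \<bullet> (r - g (Suc n))"
    using \<gamma>_pos[of "Suc n"] by (simp add: zero_le_mult_iff)
  \<comment> \<open>Adding twice the previous inequality to this expanded square cancels every inner
    product of distinct vectors.\<close>
  moreover have "0 \<le> (norm (g (Suc n) - g n - r))\<^sup>2" by simp
  ultimately have "(norm (g (Suc n)))\<^sup>2 \<le> (norm (g n))\<^sup>2 + (norm r)\<^sup>2"
    unfolding power2_norm_eq_inner by (simp add: inner_simps inner_commute)
  also have "(norm r)\<^sup>2 \<le> (\<eta> n / \<gamma> (Suc n))\<^sup>2" using r by (intro power_mono) auto
  finally show ?thesis by simp
qed

section \<open>Bounded residuals and growth of the iterates\<close>

lemma summable_a_sq: "summable (\<lambda>n. (a n)\<^sup>2)"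
proof (rule summable_comparison_test_ev[OF _ summable_a])
  have "\<forall>\<^sub>F n in sequentially. a n < 1"
    using summable_LIMSEQ_zero[OF summable_a] by (rule order_tendstoD) simp
  then show "\<forall>\<^sub>F n in sequentially. norm ((a n)\<^sup>2) \<le> a n"
    by eventually_elim (use a_nonneg in \<open>simp add: power2_eq_square mult_left_le\<close>)
qed

lemma summable_\<eta>_sq: "summable (\<lambda>n. (\<eta> n)\<^sup>2)"
proof (rule summable_comparison_test_ev[OF _ summable_\<eta>])
  have "\<forall>\<^sub>F n in sequentially. \<eta> n < 1"
    using summable_LIMSEQ_zero[OF summable_\<eta>] by (rule order_tendstoD) simp
  then show "\<forall>\<^sub>F n in sequentially. norm ((\<eta> n)\<^sup>2) \<le> \<eta> n"
    by eventually_elim (use \<eta>_nonneg in \<open>simp add: power2_eq_square mult_left_le\<close>)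
qed

lemma g_bounded: obtains M where "M \<ge> 0" "\<And>n. norm (g n) \<le> M"
proof -
  \<comment> \<open>Since \<open>G n \<ge> \<gamma> 0\<close>, the relative errors inherit square
    summability from \<open>a\<close>.\<close>
  have step: "(\<eta> n / \<gamma> (Suc n))\<^sup>2 \<le> (a n)\<^sup>2 / (\<gamma> 0)\<^sup>2" for n
  proof -
    have "\<eta> n / \<gamma> (Suc n) * \<gamma> 0 \<le> a n"
      unfolding a_def using \<eta>_nonneg \<gamma>_pos G_ge by (intro mult_left_mono) (auto simp: less_imp_le)
    then have "\<eta> n / \<gamma> (Suc n) \<le> a n / \<gamma> 0" using \<gamma>_pos[of 0] by (simp add: field_simps)
    then have "(\<eta> n / \<gamma> (Suc n))\<^sup>2 \<le> (a n / \<gamma> 0)\<^sup>2"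
      using \<eta>_nonneg \<gamma>_pos by (intro power_mono) (auto simp: less_imp_le)
    then show ?thesis by (simp add: power_divide)
  qed
  define S where "S = (\<Sum>n. (a n)\<^sup>2 / (\<gamma> 0)\<^sup>2)"
  have "(norm (g n))\<^sup>2 \<le> (norm (g 0))\<^sup>2 + (\<Sum>k<n. (a k)\<^sup>2 / (\<gamma> 0)\<^sup>2)" for n
  proof (induction n)
    case (Suc n)
    then show ?case using norm_g_sq_step[of n] step[of n] by simp
  qed simp
  moreover have "(\<Sum>k<n. (a k)\<^sup>2 / (\<gamma> 0)\<^sup>2) \<le> S" for n
    unfolding S_def by (intro sum_le_suminf summable_divide summable_a_sq) auto
  ultimately have "(norm (g n))\<^sup>2 \<le> (norm (g 0))\<^sup>2 + S" for n
    by (smt (verit))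
  then have "norm (g n) \<le> sqrt ((norm (g 0))\<^sup>2 + S)" for n
    by (rule real_le_rsqrt)
  then show ?thesis using that norm_ge_zero order_trans by blast
qed

text \<open>The iterates may be unbounded, but growth at most linear in \<open>G n\<close> is enough
  to control \<open>\<eta> n * norm (p n - u)\<close>.\<close>

lemma p_growth:
  assumes M: "\<And>n. norm (g n) \<le> M"
  shows "norm (p n - u) \<le> norm (l 0 - u) + suminf \<eta> + M * G n"
proof -
  have "norm (p n - u) \<le> norm (l 0 - u) + sum \<eta> {..<n} + M * G n"
  proof (induction n)
    case 0
    have "norm (p 0 - u) = norm (l 0 - u - \<gamma> 0 *\<^sub>R g 0)" using l_eq[of 0] by simp
    also have "\<dots> \<le> norm (l 0 - u) + \<gamma> 0 * norm (g 0)"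
      using norm_triangle_ineq4[of "l 0 - u" "\<gamma> 0 *\<^sub>R g 0"] \<gamma>_pos[of 0] by simp
    also have "\<gamma> 0 * norm (g 0) \<le> \<gamma> 0 * M" using M \<gamma>_pos[of 0] by simp
    finally show ?case by (simp add: G_def mult.commute)
  next
    case (Suc n)
    have eq: "p (Suc n) - u = (p n - u) + e n - \<gamma> (Suc n) *\<^sub>R g (Suc n)"
      using p_Suc[of n] by (simp add: algebra_simps)
    have "norm (p (Suc n) - u) \<le> norm (p n - u) + norm (e n) + norm (\<gamma> (Suc n) *\<^sub>R g (Suc n))"
      unfolding eq
      using norm_triangle_ineq4[of "(p n - u) + e n" "\<gamma> (Suc n) *\<^sub>R g (Suc n)"]
        norm_triangle_ineq[of "p n - u" "e n"] by linarith
    moreover have "norm (\<gamma> (Suc n) *\<^sub>R g (Suc n)) \<le> \<gamma> (Suc n) * M" using M \<gamma>_pos[of "Suc n"] by simp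
    ultimately show ?case using Suc norm_e[of n] by (simp add: G_Suc algebra_simps)
  qed
  moreover have "sum \<eta> {..<n} \<le> suminf \<eta>"
    by (intro sum_le_suminf summable_\<eta>) (auto simp: \<eta>_nonneg)
  ultimately show ?thesis by linarith
qed

section \<open>The Lyapunov function and its growth\<close>

definition lyapunov :: "'a \<Rightarrow> nat \<Rightarrow> real" where
  "lyapunov u n = (norm (p n - u))\<^sup>2 / 2 + G n * (hr (p n) - hr u) + (G n)\<^sup>2 * (norm (g n))\<^sup>2 / 2"

lemma lyapunov_0:
  assumes "u \<in> edom"
  shows "lyapunov u 0 \<le> (norm (l 0 - u))\<^sup>2 / 2"
proof -
  have "(norm (l 0 - u))\<^sup>2 = (norm (p 0 - u))\<^sup>2 + 2 * \<gamma> 0 * (g 0 \<bullet> (p 0 - u)) + (\<gamma> 0)\<^sup>2 * (norm (g 0))\<^sup>2"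
    unfolding l_eq[of 0] power2_norm_eq_inner by (simp add: inner_simps inner_commute algebra_simps power2_eq_square)
  moreover have "\<gamma> 0 * (hr (p 0) + g 0 \<bullet> (u - p 0)) \<le> \<gamma> 0 * hr u"
    using subgradient_ineq[OF assms] \<gamma>_pos[of 0] by (intro mult_left_mono) (auto simp: less_imp_le)
  ultimately show ?thesis unfolding lyapunov_def by (simp add: G_def algebra_simps)
qed

text \<open>Subgradient inequalities at \<open>u\<close> and \<open>p n\<close>, weighted by
  \<open>\<tau>\<close> and \<open>G n\<close>, are added to the expanded distance and the residual
  decay. The terms in \<open>q\<close> assemble to \<open>(G n + \<tau>)\<^sup>2 * q / 2\<close>:
  \<open>\<tau>\<^sup>2\<close> comes from the distance, the mixed term from \<open>p n\<close>, and
  \<open>(G n)\<^sup>2\<close> from the decay.\<close>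

lemma lyapunov_Suc:
  assumes "u \<in> edom"
  shows "lyapunov u (Suc n) \<le> lyapunov u n + \<eta> n * norm (p n - u) + (\<eta> n)\<^sup>2 / 2
    + G n * \<eta> n * norm (g (Suc n)) + (a n)\<^sup>2 / 2"
proof -
  define \<tau> g' p' q where "\<tau> = \<gamma> (Suc n)" and "g' = g (Suc n)" and "p' = p (Suc n)"
    and "q = (norm g')\<^sup>2"
  note defs = \<tau>_def[symmetric] g'_def[symmetric] p'_def[symmetric]
  have \<tau>: "\<tau> > 0" and Gn: "G n > 0" using \<gamma>_pos G_pos by (auto simp: \<tau>_def)
  have "(norm (p n + e n - u))\<^sup>2 = (norm (p' - u))\<^sup>2 + 2 * \<tau> * (g' \<bullet> (p' - u)) + \<tau>\<^sup>2 * q"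
    unfolding p_Suc[of n] defs power2_norm_eq_inner q_def
    by (simp add: inner_simps inner_commute algebra_simps power2_eq_square)
  moreover have "(norm (p n + e n - u))\<^sup>2 \<le> (norm (p n - u))\<^sup>2 + 2 * (\<eta> n * norm (p n - u)) + (\<eta> n)\<^sup>2"
  proof -
    have "norm (p n + e n - u) \<le> norm (p n - u) + \<eta> n"
      using norm_triangle_ineq[of "p n - u" "e n"] norm_e[of n] by (simp add: algebra_simps)
    then have "(norm (p n + e n - u))\<^sup>2 \<le> (norm (p n - u) + \<eta> n)\<^sup>2" by (intro power_mono) auto
    then show ?thesis by (simp add: power2_sum algebra_simps)
  qed
  moreover have "\<tau> * (hr p' - g' \<bullet> (p' - u)) \<le> \<tau> * hr u"
    using subgradient_ineq[OF assms, of "Suc n"] \<tau> unfolding defs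
    by (intro mult_left_mono) (auto simp: inner_diff_right)
  moreover have "G n * (hr p' + \<tau> * q - \<eta> n * norm g') \<le> G n * hr (p n)"
  proof (rule mult_left_mono)
    have eq: "p n - p' = \<tau> *\<^sub>R g' - e n" using p_Suc[of n] unfolding defs by (simp add: algebra_simps)
    have "hr p' + g' \<bullet> (p n - p') \<le> hr (p n)"
      using subgradient_ineq[OF p_edom, of "Suc n" n] unfolding defs .
    moreover have "g' \<bullet> e n \<le> \<eta> n * norm g'"
      using norm_cauchy_schwarz[of g' "e n"] mult_left_mono[OF norm_e[of n], of "norm g'"]
      by (simp add: mult.commute)
    ultimately show "hr p' + \<tau> * q - \<eta> n * norm g' \<le> hr (p n)"
      unfolding eq q_def power2_norm_eq_inner by (simp add: inner_diff_right)
  qed (use Gn in simp)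
  moreover have "(G n)\<^sup>2 * q \<le> (G n)\<^sup>2 * (norm (g n))\<^sup>2 + (a n)\<^sup>2"
  proof -
    have "(G n)\<^sup>2 * q \<le> (G n)\<^sup>2 * ((norm (g n))\<^sup>2 + (\<eta> n / \<tau>)\<^sup>2)"
      using norm_g_sq_step[of n] unfolding defs q_def by (intro mult_left_mono) auto
    also have "\<dots> = (G n)\<^sup>2 * (norm (g n))\<^sup>2 + (a n)\<^sup>2"
      unfolding a_def defs by (simp add: algebra_simps power_mult_distrib power_divide)
    finally show ?thesis .
  qed
  moreover have "lyapunov u (Suc n) = (norm (p' - u))\<^sup>2 / 2 + (G n + \<tau>) * (hr p' - hr u) + (G n + \<tau>)\<^sup>2 * q / 2"
    unfolding lyapunov_def G_Suc defs q_def ..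
  ultimately show ?thesis
    unfolding lyapunov_def[of u n] defs by (simp add: algebra_simps power2_sum add_divide_distrib)
qed

text \<open>Each step raises the function by at most \<open>c n * G (Suc n)\<close> with
  \<open>c\<close> summable; \<open>Kronecker_tendsto\<close> then makes the accumulated error
  \<open>o(G n)\<close>.\<close>

lemma lyapunov_sublinear:
  assumes u: "u \<in> edom"
  obtains r where "r \<longlonglongrightarrow> 0" "\<And>n. lyapunov u n \<le> r n * G n"
proof -
  obtain M where M: "M \<ge> 0" "\<And>n. norm (g n) \<le> M" by (rule g_bounded) blast
  define K where "K = norm (l 0 - u) + suminf \<eta>"
  define b where "b n = \<eta> n * K + (\<eta> n)\<^sup>2 / 2 + (a n)\<^sup>2 / 2" for n
  \<comment> \<open>Dividing by \<open>\<gamma> 0 \<le> G (Suc n)\<close> absorbs the errors without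
    a factor \<open>G\<close>. The 2 counts the growth of \<open>p n\<close> and the term with
    \<open>norm (g (Suc n))\<close>.\<close>
  define c where "c n = b n / \<gamma> 0 + 2 * M * a n" for n
  have K: "K \<ge> 0" unfolding K_def using suminf_nonneg[OF summable_\<eta>] \<eta>_nonneg by simp
  have b0: "b n \<ge> 0" for n unfolding b_def using K \<eta>_nonneg by simp
  have c0: "c n \<ge> 0" for n unfolding c_def using b0 a_nonneg M \<gamma>_pos[of 0] by (simp add: less_imp_le)
  have "summable b" unfolding b_def[abs_def]
    by (intro summable_add summable_divide summable_mult2 summable_\<eta> summable_\<eta>_sq summable_a_sq)
  then have sc: "summable c" unfolding c_def[abs_def]
    by (intro summable_add summable_divide summable_mult summable_a)
  have step: "lyapunov u (Suc n) \<le> lyapunov u n + c n * G (Suc n)" for n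
  proof -
    have "\<eta> n * norm (p n - u) \<le> \<eta> n * (K + M * G n)"
      using p_growth[OF M(2)] unfolding K_def by (intro mult_left_mono \<eta>_nonneg)
    moreover have "G n * \<eta> n * norm (g (Suc n)) \<le> G n * \<eta> n * M"
      using G_pos \<eta>_nonneg M by (intro mult_left_mono) (auto simp: less_imp_le)
    moreover have "M * (G n * \<eta> n) \<le> M * (a n * G (Suc n))"
      by (intro mult_left_mono a_le M)
    moreover have "b n \<le> b n / \<gamma> 0 * G (Suc n)"
    proof -
      have "b n / \<gamma> 0 * \<gamma> 0 \<le> b n / \<gamma> 0 * G (Suc n)"
        using b0[of n] \<gamma>_pos[of 0] by (intro mult_left_mono G_ge) auto
      then show ?thesis using \<gamma>_pos[of 0] by simp
    qed
    ultimately show ?thesis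
      using lyapunov_Suc[OF u, of n] unfolding c_def b_def[of n] by (simp add: algebra_simps)
  qed
  define L where "L = (norm (l 0 - u))\<^sup>2 / 2"
  have bound: "lyapunov u n \<le> L + (\<Sum>k<n. c k * G (Suc k))" for n
  proof (induction n)
    case 0
    then show ?case using lyapunov_0[OF u] by (simp add: L_def)
  next
    case (Suc n)
    then show ?case using step[of n] by simp
  qed
  show ?thesis
  proof (rule that)
    have "(\<lambda>n. L / G n) \<longlonglongrightarrow> 0"
      by (rule tendsto_divide_0[OF tendsto_const filterlim_at_top_imp_at_infinity[OF G_at_top]])
    from tendsto_add[OF this Kronecker_tendsto[OF sc c0 G_pos mono_G G_at_top]]
    show "(\<lambda>n. L / G n + (\<Sum>k<n. c k * G (Suc k)) / G n) \<longlonglongrightarrow> 0" by simp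
    show "lyapunov u n \<le> (L / G n + (\<Sum>k<n. c k * G (Suc k)) / G n) * G n" for n
      using bound[of n] G_pos[of n] by (simp add: distrib_right)
  qed
qed

text \<open>Bounding \<open>h (p n)\<close> from below by an affine minorant of slope \<open>z\<close> turns the Lyapunov
  function into a sum of squares.\<close>
lemma residual_bound:
  assumes u: "u \<in> edom" and c: "conjugate h z \<le> ereal c"
  obtains r where "r \<longlonglongrightarrow> 0"
    "\<And>n. (norm (p n - u + G n *\<^sub>R z))\<^sup>2 / 2 + (G n)\<^sup>2 * ((norm (g n))\<^sup>2 - (norm z)\<^sup>2) / 2
      \<le> (r n + (hr u + c - z \<bullet> u)) * G n"
proof -
  obtain r where r: "r \<longlonglongrightarrow> 0" "\<And>n. lyapunov u n \<le> r n * G n"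
    by (rule lyapunov_sublinear[OF u]) blast
  have "(norm (p n - u + G n *\<^sub>R z))\<^sup>2 / 2 + (G n)\<^sup>2 * ((norm (g n))\<^sup>2 - (norm z)\<^sup>2) / 2
      \<le> (r n + (hr u + c - z \<bullet> u)) * G n" for n
  proof -
    have "G n * (z \<bullet> p n - hr (p n)) \<le> G n * c"
      using c p_edom G_pos[of n] unfolding conjugate_le_iff by (intro mult_left_mono) auto
    moreover have "(norm (p n - u + G n *\<^sub>R z))\<^sup>2
        = (norm (p n - u))\<^sup>2 + 2 * G n * (z \<bullet> (p n - u)) + (G n)\<^sup>2 * (norm z)\<^sup>2"
      unfolding power2_norm_eq_inner by (simp add: inner_simps inner_commute algebra_simps power2_eq_square)
    ultimately show ?thesis
      using r(2)[of n] unfolding lyapunov_def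
      by (simp add: algebra_simps inner_diff_right add_divide_distrib diff_divide_distrib)
  qed
  with r(1) show ?thesis by (rule that)
qed

section \<open>Convergence of the residuals and of their conjugate values\<close>

context
  fixes sbar
  assumes sbar: "sbar = arg_min_on (\<lambda>v. (norm v)\<^sup>2) (closure (range_subdifferential h))"
begin

lemma g_obtuse: "0 \<le> sbar \<bullet> (g n - sbar)"
  using min_norm_range_subdifferential(2)[OF sbar] g_subgradient
  unfolding range_subdifferential_def by blast

lemma norm_diff_sq_le: "(norm (g n - sbar))\<^sup>2 \<le> (norm (g n))\<^sup>2 - (norm sbar)\<^sup>2"
  using g_obtuse[of n] unfolding power2_norm_eq_inner by (simp add: inner_simps inner_commute)

text \<open>As \<open>sbar\<close> may lie outside the range, it is approximated by subgradients
  \<open>z\<close> at points \<open>u\<close>. For such a pair the constant in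
  \<open>residual_bound\<close> cancels, so \<open>(norm (g n))\<^sup>2\<close> exceeds
  \<open>(norm z)\<^sup>2\<close> by at most \<open>2 * (r n / G n)\<close>; the obtuse angle at
  \<open>sbar\<close> turns this into strong convergence.\<close>

lemma g_tendsto: "g \<longlonglongrightarrow> sbar"
proof -
  have "(\<lambda>n. (norm (g n - sbar))\<^sup>2) \<longlonglongrightarrow> 0"
  proof (rule order_tendstoI)
    fix d :: real assume d: "0 < d"
    obtain Z where Z: "\<And>n. Z n \<in> range_subdifferential h" "Z \<longlonglongrightarrow> sbar"
      using min_norm_range_subdifferential(1)[OF sbar] unfolding closure_sequential by blast
    have "(\<lambda>n. (norm (Z n))\<^sup>2) \<longlonglongrightarrow> (norm sbar)\<^sup>2" by (intro tendsto_intros Z)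
    then have "\<forall>\<^sub>F n in sequentially. (norm (Z n))\<^sup>2 < (norm sbar)\<^sup>2 + d / 2"
      by (rule order_tendstoD) (use d in simp)
    then obtain k where "(norm (Z k))\<^sup>2 < (norm sbar)\<^sup>2 + d / 2"
      unfolding eventually_sequentially by blast
    with Z(1) obtain z where z: "z \<in> range_subdifferential h" "(norm z)\<^sup>2 < (norm sbar)\<^sup>2 + d / 2"
      by blast
    then obtain u where u: "z \<in> subdifferential h u" unfolding range_subdifferential_def by blast
    then have "u \<in> edom" unfolding subdifferential_iff by blast
    then obtain r where r: "r \<longlonglongrightarrow> 0"
      "\<And>n. (norm (p n - u + G n *\<^sub>R z))\<^sup>2 / 2 + (G n)\<^sup>2 * ((norm (g n))\<^sup>2 - (norm z)\<^sup>2) / 2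
        \<le> (r n + (hr u + (z \<bullet> u - hr u) - z \<bullet> u)) * G n"
      using residual_bound[OF _ conjugate_le_of_subgradient[OF u]] by blast
    have le: "(norm (g n))\<^sup>2 - (norm z)\<^sup>2 \<le> 2 * (r n / G n)" for n
    proof -
      have "(G n)\<^sup>2 * ((norm (g n))\<^sup>2 - (norm z)\<^sup>2) / 2 \<le> r n * G n"
        using r(2)[of n] zero_le_power2[of "norm (p n - u + G n *\<^sub>R z)"] by argo
      then have "G n * (G n * ((norm (g n))\<^sup>2 - (norm z)\<^sup>2)) \<le> G n * (2 * r n)"
        by (simp add: power2_eq_square algebra_simps)
      then have "G n * ((norm (g n))\<^sup>2 - (norm z)\<^sup>2) \<le> 2 * r n"
        using G_pos[of n] mult_le_cancel_left_pos by blast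
      then show ?thesis using G_pos[of n] by (simp add: field_simps)
    qed
    have "(\<lambda>n. r n / G n) \<longlonglongrightarrow> 0"
      by (rule tendsto_divide_0[OF r(1) filterlim_at_top_imp_at_infinity[OF G_at_top]])
    then have "\<forall>\<^sub>F n in sequentially. r n / G n < d / 4"
      by (rule order_tendstoD) (use d in simp)
    then show "\<forall>\<^sub>F n in sequentially. (norm (g n - sbar))\<^sup>2 < d"
    proof eventually_elim
      case (elim n)
      then show ?case using norm_diff_sq_le[of n] le[of n] z(2) by argo
    qed
  qed (simp add: order_less_le_trans)
  then have "(\<lambda>n. norm (g n - sbar)) \<longlonglongrightarrow> 0"
    using tendsto_real_sqrt[of "\<lambda>n. (norm (g n - sbar))\<^sup>2" 0 sequentially] by simp
  then show ?thesis by (rule LIM_zero_cancel[OF tendsto_norm_zero_cancel])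
qed

text \<open>One point \<open>x\<close> witnessing the strict bound at \<open>sbar\<close> still does
  so at nearby slopes; this also covers an infinite limit value.\<close>

lemma eventually_less_conjugate_g:
  assumes "b < conjugate h sbar"
  shows "\<forall>\<^sub>F n in sequentially. b < conjugate h (g n)"
proof -
  obtain x where x: "x \<in> edom" "b < ereal (sbar \<bullet> x - hr x)"
    using assms unfolding less_conjugate_iff by blast
  have "(\<lambda>n. ereal (g n \<bullet> x - hr x)) \<longlonglongrightarrow> ereal (sbar \<bullet> x - hr x)"
    by (intro tendsto_intros g_tendsto)
  then have "\<forall>\<^sub>F n in sequentially. b < ereal (g n \<bullet> x - hr x)"
    using x(2) by (rule order_tendstoD)
  then show ?thesis
    by eventually_elim (use x(1) less_conjugate_iff in blast)
qed

text \<open>The hypothesis makes the conjugate finite at \<open>sbar\<close>, so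
  \<open>residual_bound\<close> applies with \<open>z = sbar\<close>. It controls
  \<open>p n \<bullet> (g n - sbar)\<close> although \<open>p n\<close> may be unbounded.\<close>

lemma eventually_conjugate_g_less:
  assumes "conjugate h sbar < b"
  shows "\<forall>\<^sub>F n in sequentially. conjugate h (g n) < b"
proof -
  obtain c where c: "conjugate h sbar < ereal c" "ereal c < b"
    using assms ereal_dense2 by blast
  obtain x where "x \<in> edom" using edom_nonempty by blast
  then have "conjugate h sbar \<noteq> - \<infinity>"
    using less_conjugate_iff[of "- \<infinity>" sbar] by auto
  with c(1) obtain C where C: "conjugate h sbar = ereal C" "C < c"
    by (cases "conjugate h sbar") auto
  have "ereal (C - (c - C) / 2) < conjugate h sbar" unfolding C(1) using C(2) by simp
  \<comment> \<open>Such a nearly optimal \<open>u\<close> keeps the Fenchel gap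
    \<open>\<delta>\<close> below half of \<open>c - C\<close>, so the limiting bound
    \<open>C + \<delta>\<close> lies below \<open>c\<close>.\<close>
  then obtain u where u: "u \<in> edom" "C - (c - C) / 2 < sbar \<bullet> u - hr u"
    unfolding less_conjugate_iff by auto
  define \<delta> where "\<delta> = hr u + C - sbar \<bullet> u"
  have \<delta>: "\<delta> < (c - C) / 2" using u(2) by (simp add: \<delta>_def field_simps)
  obtain r where r: "r \<longlonglongrightarrow> 0"
    "\<And>n. (norm (p n - u + G n *\<^sub>R sbar))\<^sup>2 / 2 + (G n)\<^sup>2 * ((norm (g n))\<^sup>2 - (norm sbar)\<^sup>2) / 2
      \<le> (r n + (hr u + C - sbar \<bullet> u)) * G n"
    by (rule residual_bound[OF u(1), of sbar C]) (use C(1) in auto)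
  have key: "conjugate h (g n) \<le> ereal (C + (\<delta> + r n + u \<bullet> (g n - sbar)))" for n
  proof -
    define w where "w = p n - u + G n *\<^sub>R sbar"
    define d where "d = g n - sbar"
    \<comment> \<open>Young's inequality is weighted to match the two squares in
      \<open>residual_bound\<close>.\<close>
    have "G n * (w \<bullet> d) \<le> (norm w)\<^sup>2 / 2 + (G n)\<^sup>2 * (norm d)\<^sup>2 / 2"
      using zero_le_power2[of "norm (w - G n *\<^sub>R d)"] unfolding power2_norm_eq_inner
      by (simp add: inner_simps inner_commute algebra_simps power2_eq_square)
    also have "(G n)\<^sup>2 * (norm d)\<^sup>2 \<le> (G n)\<^sup>2 * ((norm (g n))\<^sup>2 - (norm sbar)\<^sup>2)"
      unfolding d_def by (intro mult_left_mono norm_diff_sq_le) auto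
    finally have "G n * (w \<bullet> d) \<le> G n * (r n + \<delta>)"
      using r(2)[of n] unfolding w_def \<delta>_def by (simp add: mult.commute)
    then have "w \<bullet> d \<le> r n + \<delta>" using G_pos[of n] by simp
    \<comment> \<open>Replacing \<open>p n\<close> by \<open>w\<close> and \<open>u\<close> leaves
      \<open>- G n * (sbar \<bullet> d)\<close>, a growing weight whose sign is favourable by
      \<open>g_obtuse\<close>.\<close>
    moreover have "0 \<le> G n * (sbar \<bullet> d)"
      unfolding d_def using G_pos[of n] g_obtuse[of n] by simp
    moreover have "p n \<bullet> d = w \<bullet> d + u \<bullet> d - G n * (sbar \<bullet> d)"
      by (simp add: w_def inner_simps)
    moreover have "sbar \<bullet> p n - hr (p n) \<le> C"
      using C(1) p_edom conjugate_le_iff[of sbar C] by simp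
    moreover have "g n \<bullet> p n = sbar \<bullet> p n + p n \<bullet> d"
      by (simp add: d_def inner_simps inner_commute)
    ultimately have "g n \<bullet> p n - hr (p n) \<le> C + (\<delta> + r n + u \<bullet> d)" by linarith
    then show ?thesis
      using conjugate_le_of_subgradient[OF g_subgradient[of n]] unfolding d_def
      by (meson ereal_less_eq(3) order_trans)
  qed
  have "(\<lambda>n. C + (\<delta> + r n + u \<bullet> (g n - sbar))) \<longlonglongrightarrow> C + (\<delta> + 0 + u \<bullet> (sbar - sbar))"
    by (intro tendsto_intros r(1) g_tendsto)
  then have "\<forall>\<^sub>F n in sequentially. C + (\<delta> + r n + u \<bullet> (g n - sbar)) < c"
    by (rule order_tendstoD) (use \<delta> C(2) in simp)
  then show ?thesis
  proof eventually_elim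
    case (elim n)
    then have "ereal (C + (\<delta> + r n + u \<bullet> (g n - sbar))) < ereal c" by simp
    with key[of n] c(2) show ?case by (meson order_le_less_trans order_less_trans)
  qed
qed

lemma conjugate_g_tendsto: "(\<lambda>n. conjugate h (g n)) \<longlonglongrightarrow> conjugate h sbar"
  by (rule order_tendstoI) (fact eventually_less_conjugate_g eventually_conjugate_g_less)+

end

end

theorem theorem2p5:
  fixes h :: "'a::{real_inner, complete_space} \<Rightarrow> ereal"
    and \<gamma> \<epsilon> :: "nat \<Rightarrow> real"
    and lstar sstar l s :: "nat \<Rightarrow> 'a"
    and sbar :: 'a
  assumes "proper_fun h" and "closed_fun h" and "convex_fun h"
    and "error_step_conditions \<gamma> \<epsilon>"
    and "ippa h \<gamma> \<epsilon> lstar sstar l s"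
    and "sbar = arg_min_on (\<lambda>v. (norm v)\<^sup>2) (closure (range_subdifferential h))"
  shows "(\<lambda>k. conjugate h (sstar (Suc k))) \<longlonglongrightarrow> conjugate h sbar"
proof -
  interpret inexact_proximal_run h \<gamma> \<epsilon> lstar sstar l s
    by unfold_locales (use assms in auto)
  show ?thesis using conjugate_g_tendsto[OF assms(6)] unfolding g_def .
qed

end
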